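(* Let $p$ be an odd prime. Then $$\sum_{n=0}^{p-1}\frac{G_n}{16^n}\equiv p^2\Big(1-\sum_{k=0}^{\frac{p-1}{2}}\frac{\binom{2k}{k}^2}{16^k(k+1)}H_k\Big)\pmod{p^3}.$$
   Context: For $n\ge0$, $G_n=\sum_{k=0}^n \binom{2k}{k}^2\binom{2n-2k}{n-k}4^{n-k}$. $H_0=0$ and $H_k=\sum_{i=1}^k1/i$ for $k\ge1$. Congruences between rationals with denominators prime to $p$ are taken in the ring of such rationals. *)

theory Defs
  imports Complex_Main "HOL-Computational_Algebra.Primes"
begin

definition G :: "nat \<Rightarrow> nat" where
  "G n = (\<Sum>k=0..n. ((2 * k) choose k)^2 * ((2 * n - 2 * k) choose (n - k)) * 4 ^ (n - k))"

definition H :: "nat \<Rightarrow> rat" where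
  "H k = (\<Sum>i=1..k. 1 / of_nat i)"

definition p_integral_rats :: "nat \<Rightarrow> rat set" where
  "p_integral_rats p = {x. coprime (snd (quotient_of x)) (int p)}"

text \<open>Congruence modulo the ideal generated by \<open>m\<close> in the ring of \<open>p\<close>-integral
  rationals. Both sides are required to lie in that ring.\<close>

definition p_integral_cong :: "nat \<Rightarrow> rat \<Rightarrow> rat \<Rightarrow> rat \<Rightarrow> bool" where
  "p_integral_cong p x y m \<longleftrightarrow>
     x \<in> p_integral_rats p \<and> y \<in> p_integral_rats p \<and>
     (\<exists>c \<in> p_integral_rats p. x - y = m * c)"

end

(*
  Write c_k = C(2k,k)/4^k. Pfaff's transformation of 2F1(1/2,1/2;1;x), read off coefficientwise
  and proved by two applications of Vandermonde's identity to c_k = (-1)^k C(-1/2,k), gives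
  G_n/16^n = sum_k (-1)^k C(n,k) c_k^2. Summing over n < p turns C(n,k) into
  C(p,k+1) = p/(k+1) C(p-1,k), and (-1)^k C(p-1,k) = 1 - p H_k modulo p^2. For k <= (p-1)/2 the part
  without H_k telescopes, sum_{k<=n} c_k^2/(k+1) = (2n+1)^2/(n+1) c_n^2, so for n = (p-1)/2 it
  contributes a multiple of p^3. The terms with (p-1)/2 < k < p-1 vanish modulo p^3 because p
  divides both C(p,k+1) and C(2k,k), and the term k = p-1 is p^2 modulo p^3.
*)
theory Submission
  imports Defs "HOL-Computational_Algebra.Formal_Power_Series" "HOL-Number_Theory.Residues"
begin

section \<open>Normalised central binomials and the binomial transform behind G\<close>

definition cb :: "nat \<Rightarrow> rat" where
  "cb k = of_nat (2 * k choose k) / 4 ^ k"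

lemma Suc_times_central_binomial:
  "Suc k * (2 * Suc k choose Suc k) = 2 * (2 * k + 1) * (2 * k choose k)"
proof -
  have "Suc k * (2 * Suc k choose Suc k) = 2 * (Suc k * (Suc (2 * k) choose k))"
    using Suc_times_binomial[of k "Suc (2 * k)"] by simp
  also have "Suc k * (Suc (2 * k) choose k) = (2 * k + 1) * (2 * k choose k)"
    using binomial_absorb_comp[of "Suc (2 * k)" k] by simp
  finally show ?thesis by simp
qed

lemma cb_Suc: "cb (Suc k) = cb k * (2 * of_nat k + 1) / (2 * (of_nat k + 1))"
proof -
  have "(of_nat k + 1) * of_nat (2 * Suc k choose Suc k)
      = 2 * (2 * of_nat k + 1) * (of_nat (2 * k choose k) :: rat)"
    using arg_cong[OF Suc_times_central_binomial[of k], of "of_nat :: nat \<Rightarrow> rat"]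
    by (simp only: of_nat_mult of_nat_Suc of_nat_add of_nat_numeral of_nat_1 add.commute)
  moreover have nz: "of_nat k + 1 \<noteq> (0 :: rat)"
    using of_nat_neq_0[of k, where 'a = rat] by (simp add: add.commute)
  ultimately have *: "of_nat (2 * Suc k choose Suc k)
      = 2 * (2 * of_nat k + 1) * of_nat (2 * k choose k) / (of_nat k + 1 :: rat)"
    by (simp add: field_simps del: binomial_Suc_Suc mult_Suc_right)
  show ?thesis
    unfolding cb_def * using nz by (simp add: divide_simps) (simp add: algebra_simps)
qed

text \<open>The successive ratio (-1/2 - k)/(k + 1) on the left is the negative of the ratio in
  \<open>cb_Suc\<close>. This makes Vandermonde's identity available for \<open>cb\<close>.\<close>

lemma minus_half_gchoose: "(- (1 / 2)) gchoose k = (- 1) ^ k * cb k"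
proof (induction k)
  case 0
  then show ?case by (simp add: cb_def)
next
  case (Suc k)
  have "(- (1 / 2) :: rat) gchoose Suc k = ((- (1 / 2)) gchoose k) * (- (1 / 2) - of_nat k) / (of_nat k + 1)"
    using of_nat_neq_0[of k, where 'a = rat] gbinomial_mult_1[of "- (1 / 2) :: rat" k]
    by (simp add: divide_simps) (simp add: algebra_simps)
  then show ?case
    by (simp add: Suc cb_Suc field_simps)
qed

text \<open>Vandermonde with upper arguments -1/2 and n gives C(n - 1/2, n), and negating the upper
  index turns this into (-1)^n C(-1/2, n). So \<open>cb\<close> is fixed by the alternating binomial
  transform.\<close>

lemma cb_binomial_transform: "(\<Sum>k=0..n. (- 1) ^ k * of_nat (n choose k) * cb k) = cb n"
proof -
  have "(\<Sum>k=0..n. (- 1) ^ k * of_nat (n choose k) * cb k)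
      = (\<Sum>k=0..n. ((- (1 / 2)) gchoose k) * (of_nat n gchoose (n - k)))"
    by (intro sum.cong refl)
      (simp add: minus_half_gchoose binomial_gbinomial[symmetric] binomial_symmetric[symmetric])
  also have "\<dots> = (- (1 / 2) + of_nat n) gchoose n"
    by (rule gbinomial_Vandermonde)
  also have "\<dots> = (- 1) ^ n * ((- (1 / 2)) gchoose n)"
    by (subst gbinomial_negated_upper) simp
  finally show ?thesis
    by (simp add: minus_half_gchoose flip: mult.assoc power_add)
qed

text \<open>Trinomial revision C(a,m) C(m,k) = C(a,k) C(a-k,m-k) at a = -1/2. It confines the
  dependence on \<open>m\<close> to a sign and one binomial, ready for a Vandermonde sum over
  \<open>m\<close>.\<close>

lemma cb_times_binomial:
  assumes "k \<le> m"
  shows "cb m * of_nat (m choose k) = (- 1) ^ (m - k) * cb k * ((- (1 / 2) - of_nat k) gchoose (m - k))"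
proof -
  have "(- 1) ^ m * cb m * of_nat (m choose k)
      = (- 1) ^ k * cb k * ((- (1 / 2) - of_nat k) gchoose (m - k))"
    using gbinomial_trinomial_revision[OF assms, of "- (1 / 2) :: rat"]
    by (simp add: minus_half_gchoose binomial_gbinomial)
  then have "(- 1) ^ m * ((- 1) ^ m * cb m * of_nat (m choose k))
      = (- 1) ^ m * ((- 1) ^ k * cb k * ((- (1 / 2) - of_nat k) gchoose (m - k)))"
    by (rule arg_cong)
  moreover have "(- 1 :: rat) ^ m * (- 1) ^ k = (- 1) ^ (m - k)"
    using assms by (simp add: uminus_power_if)
  ultimately show ?thesis
    by (simp flip: mult.assoc power_add)
qed

text \<open>In generating functions: c_k x^k (1-x)^(-1/2-k) times (1-x)^(-1/2) is c_k x^k /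
  (1-x)^(k+1), whose coefficient at x^n is c_k C(n,k).\<close>

lemma sum_cb_times_binomial:
  assumes "k \<le> n"
  shows "(\<Sum>m=k..n. cb m * of_nat (m choose k) * cb (n - m)) = cb k * of_nat (n choose k)"
proof -
  have "(\<Sum>m=k..n. cb m * of_nat (m choose k) * cb (n - m))
      = (\<Sum>j=0..n - k. cb (j + k) * of_nat (j + k choose k) * cb (n - k - j))"
    using assms
    by (intro sum.reindex_bij_witness[of _ "\<lambda>j. j + k" "\<lambda>m. m - k"]) auto
  also have "\<dots> = (\<Sum>j=0..n - k. (- 1) ^ (n - k) * cb k *
      (((- (1 / 2) - of_nat k) gchoose j) * ((- (1 / 2)) gchoose (n - k - j))))"
    by (intro sum.cong refl)
      (auto simp: cb_times_binomial minus_half_gchoose uminus_power_if)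
  also have "\<dots> = (- 1) ^ (n - k) * cb k * ((- (1 / 2) - of_nat k + - (1 / 2)) gchoose (n - k))"
    unfolding sum_distrib_left[symmetric] gbinomial_Vandermonde ..
  \<comment> \<open>The upper arguments add up to -1 - k, an integer; negating the upper index gives
    an ordinary binomial coefficient.\<close>
  also have "(- (1 / 2) - of_nat k + - (1 / 2) :: rat) gchoose (n - k)
      = (- 1) ^ (n - k) * (of_nat n gchoose (n - k))"
    using assms by (subst gbinomial_negated_upper) (simp add: of_nat_diff)
  also have "of_nat n gchoose (n - k) = (of_nat (n choose k) :: rat)"
    using assms by (simp add: binomial_gbinomial[symmetric] binomial_symmetric[symmetric])
  finally show ?thesis by (simp flip: mult.assoc power_add)
qed

text \<open>G_n/16^n is the convolution of c_m^2 with c_(n-m). Expanding one factor c_m by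
  \<open>cb_binomial_transform\<close> and swapping the sums leaves inner sums that
  \<open>sum_cb_times_binomial\<close> evaluates.\<close>

lemma G_eq_binomial_transform:
  "of_nat (G n) / 16 ^ n = (\<Sum>k=0..n. (- 1) ^ k * of_nat (n choose k) * (cb k)\<^sup>2)"
proof -
  \<comment> \<open>The square normalises the squared central binomial, one factor
    \<open>4 ^ (n - k)\<close> cancels the power of 4 in \<open>G\<close>, and the other normalises
    the remaining binomial.\<close>
  have 16: "(16 :: rat) ^ n = (4 ^ k)\<^sup>2 * 4 ^ (n - k) * 4 ^ (n - k)" if "k \<le> n" for k
  proof -
    have "(16 :: rat) ^ n = 4 ^ (2 * n)" by (simp add: power_mult)
    also have "2 * n = k * 2 + (n - k) + (n - k)" using that by simp
    also have "(4 :: rat) ^ \<dots> = (4 ^ k)\<^sup>2 * 4 ^ (n - k) * 4 ^ (n - k)"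
      by (simp only: power_add power_mult)
    finally show ?thesis .
  qed
  have "of_nat (G n) / 16 ^ n = (\<Sum>m=0..n. (cb m)\<^sup>2 * cb (n - m))"
    unfolding G_def of_nat_sum sum_divide_distrib
    by (intro sum.cong refl) (auto simp: 16 cb_def power_divide diff_mult_distrib2)
  also have "\<dots> = (\<Sum>m=0..n. \<Sum>k=0..n. (- 1) ^ k * cb k * (cb m * of_nat (m choose k) * cb (n - m)))"
  proof (intro sum.cong refl)
    fix m assume "m \<in> {0..n}"
    \<comment> \<open>The terms with k > m vanish; a range independent of \<open>m\<close> lets the
      two sums be swapped.\<close>
    then have "cb m = (\<Sum>k=0..n. (- 1) ^ k * of_nat (m choose k) * cb k)"
      by (subst cb_binomial_transform[symmetric], intro sum.mono_neutral_left) auto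
    then have "(cb m)\<^sup>2 * cb (n - m) = cb m * cb (n - m) * (\<Sum>k=0..n. (- 1) ^ k * of_nat (m choose k) * cb k)"
      by (simp add: power2_eq_square)
    then show "(cb m)\<^sup>2 * cb (n - m)
        = (\<Sum>k=0..n. (- 1) ^ k * cb k * (cb m * of_nat (m choose k) * cb (n - m)))"
      by (simp add: sum_distrib_left ac_simps)
  qed
  also have "\<dots> = (\<Sum>k=0..n. (- 1) ^ k * cb k * (\<Sum>m=0..n. cb m * of_nat (m choose k) * cb (n - m)))"
    by (subst sum.swap) (simp add: sum_distrib_left)
  also have "\<dots> = (\<Sum>k=0..n. (- 1) ^ k * cb k * (\<Sum>m=k..n. cb m * of_nat (m choose k) * cb (n - m)))"
    by (intro sum.cong arg_cong2[of _ _ _ _ "(*)"] refl sum.mono_neutral_right) auto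
  also have "\<dots> = (\<Sum>k=0..n. (- 1) ^ k * of_nat (n choose k) * (cb k)\<^sup>2)"
    by (intro sum.cong refl) (simp add: sum_cb_times_binomial power2_eq_square)
  finally show ?thesis .
qed

text \<open>Hockey-stick summation of C(n,k) over n. At N = p - 1 the coefficient becomes C(p,k+1),
  the source of a factor p.\<close>

lemma sum_G:
  "(\<Sum>n=0..N. of_nat (G n) / 16 ^ n) = (\<Sum>k=0..N. (- 1) ^ k * of_nat (Suc N choose Suc k) * (cb k)\<^sup>2)"
proof -
  have "(\<Sum>n=0..N. of_nat (G n) / 16 ^ n)
      = (\<Sum>n=0..N. \<Sum>k=0..N. (- 1) ^ k * of_nat (n choose k) * (cb k)\<^sup>2)"
    unfolding G_eq_binomial_transform by (intro sum.cong refl sum.mono_neutral_left) auto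
  also have "\<dots> = (\<Sum>k=0..N. (- 1) ^ k * of_nat (\<Sum>n\<le>N. n choose k) * (cb k)\<^sup>2)"
    by (subst sum.swap) (simp add: sum_distrib_left sum_distrib_right atMost_atLeast0)
  finally show ?thesis unfolding sum_choose_upper .
qed

text \<open>Meant for n = (p-1)/2, where 2n + 1 = p and the closed form acquires a factor
  p^2.\<close>

lemma sum_cb_squared_over_Suc:
  "(\<Sum>k=0..n. (cb k)\<^sup>2 / of_nat (k + 1)) = (2 * of_nat n + 1)\<^sup>2 / of_nat (n + 1) * (cb n)\<^sup>2"
proof (induction n)
  case 0
  then show ?case by simp
next
  case (Suc n)
  have nz: "of_nat n + 1 \<noteq> (0 :: rat)" "of_nat n + 2 \<noteq> (0 :: rat)"
    using of_nat_neq_0[of n, where 'a = rat] of_nat_neq_0[of "Suc n", where 'a = rat]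
    by (simp_all add: add.commute)
  have "(2 * of_nat n + 1)\<^sup>2 * (cb n)\<^sup>2 = 4 * (of_nat n + 1)\<^sup>2 * (cb (Suc n))\<^sup>2"
  proof -
    have "cb n * (2 * of_nat n + 1) = 2 * (of_nat n + 1) * cb (Suc n)"
      using nz by (simp add: cb_Suc)
    then have "(cb n * (2 * of_nat n + 1))\<^sup>2 = (2 * (of_nat n + 1) * cb (Suc n))\<^sup>2"
      by simp
    then show ?thesis by (simp add: power2_eq_square algebra_simps)
  qed
  then have *: "(2 * of_nat n + 1)\<^sup>2 / of_nat (n + 1) * (cb n)\<^sup>2 = 4 * (of_nat n + 1) * (cb (Suc n))\<^sup>2"
    using nz by (simp add: field_simps power2_eq_square)
  have "(\<Sum>k=0..Suc n. (cb k)\<^sup>2 / of_nat (k + 1))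
      = 4 * (of_nat n + 1) * (cb (Suc n))\<^sup>2 + (cb (Suc n))\<^sup>2 / (of_nat n + 2)"
    unfolding sum.atLeast0_atMost_Suc Suc * by (simp add: add.commute)
  \<comment> \<open>This rests on 4(n+1)(n+2) + 1 = (2n+3)^2.\<close>
  also have "\<dots> = (2 * of_nat (Suc n) + 1)\<^sup>2 / of_nat (Suc n + 1) * (cb (Suc n))\<^sup>2"
    using nz by (simp add: field_simps power2_eq_square)
  finally show ?case .
qed

section \<open>The ring of p-integral rationals\<close>

context
  fixes p :: nat
  assumes p: "prime p"
begin

text \<open>The reduced denominator divides every other denominator, so any representation as a
  fraction may serve as witness. Closure under sums and products then needs no reduction to lowest
  terms.\<close>

lemma p_integral_rats_iff:
  "x \<in> p_integral_rats p \<longleftrightarrow> (\<exists>a b. \<not> int p dvd b \<and> x = of_int a / of_int b)"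
proof
  assume x: "x \<in> p_integral_rats p"
  obtain a b where ab: "quotient_of x = (a, b)" by fastforce
  with x have "coprime b (int p)" by (simp add: p_integral_rats_def)
  moreover have "\<not> is_unit (int p)" using p not_prime_1 by auto
  ultimately have "\<not> int p dvd b" using coprime_common_divisor[of b "int p" "int p"] by auto
  with quotient_of_div[OF ab] show "\<exists>a b. \<not> int p dvd b \<and> x = of_int a / of_int b" by blast
next
  assume "\<exists>a b. \<not> int p dvd b \<and> x = of_int a / of_int b"
  then obtain a b where b: "\<not> int p dvd b" and x: "x = of_int a / of_int b" by blast
  obtain c d where cd: "quotient_of x = (c, d)" by fastforce
  have "d > 0" "coprime c d"
    using quotient_of_denom_pos[OF cd] quotient_of_coprime[OF cd] by auto
  moreover have "b \<noteq> 0" using b by auto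
  ultimately have "(of_int (c * b) :: rat) = of_int (a * d)"
    using quotient_of_div[OF cd] x by (simp add: field_simps)
  then have "c * b = a * d" by (simp only: of_int_eq_iff)
  then have "d dvd c * b" by simp
  with \<open>coprime c d\<close> have "d dvd b"
    by (simp add: coprime_commute coprime_dvd_mult_right_iff)
  moreover have "coprime b (int p)"
    using b p prime_imp_coprime[of "int p" b] by (simp add: coprime_commute)
  ultimately have "coprime d (int p)" using coprime_divisors[of d b "int p" "int p"] by auto
  then show "x \<in> p_integral_rats p" by (simp add: p_integral_rats_def cd)
qed

lemma p_integral_of_int: "of_int a \<in> p_integral_rats p"
  unfolding p_integral_rats_iff using p not_prime_1
  by (intro exI[of _ a] exI[of _ 1]) auto

lemma p_integral_of_nat: "of_nat n \<in> p_integral_rats p"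
  using p_integral_of_int[of "int n"] by simp

lemma p_integral_numeral: "0 \<in> p_integral_rats p" "1 \<in> p_integral_rats p" "numeral w \<in> p_integral_rats p"
  using p_integral_of_int[of 0] p_integral_of_int[of 1] p_integral_of_int[of "numeral w"] by simp_all

lemma p_integral_add:
  assumes "x \<in> p_integral_rats p" "y \<in> p_integral_rats p"
  shows "x + y \<in> p_integral_rats p"
proof -
  obtain a b c d where "\<not> int p dvd b" "x = of_int a / of_int b" "\<not> int p dvd d" "y = of_int c / of_int d"
    using assms p_integral_rats_iff by blast
  moreover from this have "b \<noteq> 0" "d \<noteq> 0" by auto
  ultimately show ?thesis
    unfolding p_integral_rats_iff using p
    by (intro exI[of _ "a * d + c * b"] exI[of _ "b * d"]) (simp add: prime_dvd_mult_iff field_simps)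
qed

lemma p_integral_mult:
  assumes "x \<in> p_integral_rats p" "y \<in> p_integral_rats p"
  shows "x * y \<in> p_integral_rats p"
proof -
  obtain a b c d where "\<not> int p dvd b" "x = of_int a / of_int b" "\<not> int p dvd d" "y = of_int c / of_int d"
    using assms p_integral_rats_iff by blast
  then show ?thesis
    unfolding p_integral_rats_iff using p
    by (intro exI[of _ "a * c"] exI[of _ "b * d"]) (simp add: prime_dvd_mult_iff)
qed

lemma p_integral_uminus: "x \<in> p_integral_rats p \<Longrightarrow> - x \<in> p_integral_rats p"
  using p_integral_mult[OF p_integral_of_int[of "- 1"]] by simp

lemma p_integral_diff: "x \<in> p_integral_rats p \<Longrightarrow> y \<in> p_integral_rats p \<Longrightarrow> x - y \<in> p_integral_rats p"
  using p_integral_add[OF _ p_integral_uminus] by simp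

lemma p_integral_power: "x \<in> p_integral_rats p \<Longrightarrow> x ^ n \<in> p_integral_rats p"
  by (induction n) (simp_all add: p_integral_numeral p_integral_mult)

lemma p_integral_sum: "(\<And>i. i \<in> A \<Longrightarrow> f i \<in> p_integral_rats p) \<Longrightarrow> sum f A \<in> p_integral_rats p"
  by (induction A rule: infinite_finite_induct) (simp_all add: p_integral_numeral p_integral_add)

lemma p_integral_divide:
  assumes "x \<in> p_integral_rats p" "\<not> p dvd n"
  shows "x / of_nat n \<in> p_integral_rats p"
proof -
  have "(1 :: rat) / of_nat n \<in> p_integral_rats p"
    unfolding p_integral_rats_iff using assms
    by (intro exI[of _ 1] exI[of _ "int n"]) simp
  from p_integral_mult[OF assms(1) this] show ?thesis by simp
qed

lemma p_integral_divide_Suc: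
  assumes "x \<in> p_integral_rats p" "Suc k < p"
  shows "x / (of_nat k + 1) \<in> p_integral_rats p"
proof -
  have "\<not> p dvd Suc k" using assms(2) by (auto dest: dvd_imp_le)
  from p_integral_divide[OF assms(1) this] show ?thesis by (simp add: add.commute)
qed

lemmas p_integral_intros = p_integral_of_nat p_integral_numeral p_integral_add p_integral_mult
  p_integral_uminus p_integral_diff p_integral_power p_integral_sum

lemma p_integral_H:
  assumes "k < p"
  shows "H k \<in> p_integral_rats p"
  unfolding H_def using assms
  by (intro p_integral_sum p_integral_divide p_integral_numeral) (auto dest: dvd_imp_le)

section \<open>Congruence calculus, then binomial coefficients with upper index near p\<close>

lemma p_integral_cong_refl: "x \<in> p_integral_rats p \<Longrightarrow> p_integral_cong p x x m"
  unfolding p_integral_cong_def using p_integral_numeral(1) by force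

text \<open>Integrality of \<open>x\<close> follows from the equation, so it is not among the
  premises.\<close>

lemma p_integral_congI:
  assumes "y \<in> p_integral_rats p" "m \<in> p_integral_rats p" "c \<in> p_integral_rats p" "x = y + m * c"
  shows "p_integral_cong p x y m"
  unfolding p_integral_cong_def using assms by (auto intro!: p_integral_add p_integral_mult)

lemma p_integral_congE:
  assumes "p_integral_cong p x y m"
  obtains c where "c \<in> p_integral_rats p" "x = y + m * c"
  using assms unfolding p_integral_cong_def by (metis add.commute diff_add_cancel)

lemma p_integral_cong_trans:
  assumes "p_integral_cong p x y m" "p_integral_cong p y z m"
  shows "p_integral_cong p x z m"
proof -
  obtain c d where "c \<in> p_integral_rats p" "x - y = m * c" "d \<in> p_integral_rats p" "y - z = m * d"
    using assms unfolding p_integral_cong_def by blast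
  moreover from this have "x - z = m * (c + d)" by (simp add: algebra_simps)
  ultimately show ?thesis
    using assms unfolding p_integral_cong_def
    by (intro conjI bexI[of _ "c + d"]) (auto intro: p_integral_add)
qed

lemma p_integral_cong_add:
  assumes "p_integral_cong p x y m" "p_integral_cong p x' y' m"
  shows "p_integral_cong p (x + x') (y + y') m"
proof -
  obtain c d where "c \<in> p_integral_rats p" "x - y = m * c" "d \<in> p_integral_rats p" "x' - y' = m * d"
    using assms unfolding p_integral_cong_def by blast
  moreover from this have "(x + x') - (y + y') = m * (c + d)" by (simp add: algebra_simps)
  ultimately show ?thesis
    using assms unfolding p_integral_cong_def
    by (intro conjI bexI[of _ "c + d"]) (auto intro: p_integral_add)
qed

lemma p_integral_cong_sum:
  "(\<And>i. i \<in> A \<Longrightarrow> p_integral_cong p (f i) (g i) m) \<Longrightarrow> p_integral_cong p (sum f A) (sum g A) m"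
  by (induction A rule: infinite_finite_induct)
    (simp_all add: p_integral_cong_refl p_integral_numeral p_integral_cong_add)

lemma p_integral_cong_mult:
  assumes "p_integral_cong p x y m" "p_integral_cong p x' y' m"
  shows "p_integral_cong p (x * x') (y * y') m"
proof -
  obtain c d where "c \<in> p_integral_rats p" "x - y = m * c" "d \<in> p_integral_rats p" "x' - y' = m * d"
    using assms unfolding p_integral_cong_def by blast
  moreover from this have "x * x' - y * y' = m * (c * x' + y * d)"
  proof -
    have "x * x' - y * y' = (x - y) * x' + y * (x' - y')" by (simp add: algebra_simps)
    then show ?thesis using calculation by (simp add: algebra_simps)
  qed
  ultimately show ?thesis
    using assms unfolding p_integral_cong_def
    by (intro conjI bexI[of _ "c * x' + y * d"]) (auto intro: p_integral_add p_integral_mult)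
qed

text \<open>The modulus is scaled as well: an explicit factor p or p^2 thus lifts a congruence to
  one modulo p^3.\<close>

lemma p_integral_cong_scale:
  assumes "p_integral_cong p x y m" "d \<in> p_integral_rats p"
  shows "p_integral_cong p (d * x) (d * y) (d * m)"
  using assms unfolding p_integral_cong_def
  by (auto simp: p_integral_mult mult.assoc simp flip: right_diff_distrib)

lemma p_integral_cong_modulus:
  assumes "p_integral_cong p x y (m * d)" "d \<in> p_integral_rats p"
  shows "p_integral_cong p x y m"
  using assms p_integral_mult unfolding p_integral_cong_def by (metis mult.assoc)

lemma p_integral_cong_of_nat:
  assumes "[a = b] (mod m)"
  shows "p_integral_cong p (of_nat a) (of_nat b) (of_nat m)"
proof -
  have "int m dvd int a - int b"
    using assms by (simp add: cong_iff_dvd_diff flip: cong_int_iff)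
  then obtain c where "int a - int b = int m * c" by blast
  then have "of_nat a - of_nat b = (of_nat m * of_int c :: rat)"
    by (metis of_int_diff of_int_mult of_int_of_nat_eq)
  then show ?thesis
    using p_integral_of_int p_integral_of_nat unfolding p_integral_cong_def by blast
qed

text \<open>The left side is the product of 1 - p/i over 1 \<le> i \<le> k; modulo p^2 only the
  terms of degree at most one in p survive.\<close>

lemma choose_p_minus_1_cong:
  "k < p \<Longrightarrow> p_integral_cong p ((- 1) ^ k * of_nat (p - 1 choose k)) (1 - of_nat p * H k) (of_nat p ^ 2)"
proof (induction k)
  case 0
  then show ?case by (simp add: H_def p_integral_cong_refl p_integral_numeral)
next
  case (Suc k)
  let ?s = "of_nat k + 1 :: rat"
  let ?P = "of_nat p :: rat"
  have nz: "?s \<noteq> 0" using of_nat_neq_0[of k, where 'a = rat] by (simp add: add.commute)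
  obtain c where c: "c \<in> p_integral_rats p"
    "(- 1) ^ k * of_nat (p - 1 choose k) = 1 - ?P * H k + ?P ^ 2 * c"
    using Suc by (auto elim: p_integral_congE)
  have "Suc k * (p - 1 choose Suc k) = (p - 1 - k) * (p - 1 choose k)"
    by (simp only: binomial_absorption binomial_absorb_comp)
  then have "(of_nat (Suc k) * of_nat (p - 1 choose Suc k) :: rat)
      = of_nat (p - 1 - k) * of_nat (p - 1 choose k)"
    by (metis of_nat_mult)
  moreover have "of_nat (p - 1 - k) = ?P - ?s"
    using Suc.prems by (simp add: of_nat_diff)
  ultimately have *: "of_nat (p - 1 choose Suc k) = (?P - ?s) / ?s * of_nat (p - 1 choose k)"
    using nz by (simp add: field_simps)
  have "(- 1) ^ Suc k * of_nat (p - 1 choose Suc k)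
      = (1 - ?P / ?s) * ((- 1) ^ k * of_nat (p - 1 choose k))"
    unfolding * using nz by (simp add: field_simps)
  \<comment> \<open>The last bracket collects everything of order p^2 and is the new witness,
    integral because k + 1 < p.\<close>
  also have "\<dots> = 1 - ?P * (H k + 1 / ?s) + ?P ^ 2 * (c + H k / ?s - ?P * (c / ?s))"
    unfolding c(2) by (simp add: algebra_simps power2_eq_square)
  also have "H k + 1 / ?s = H (Suc k)"
    by (simp add: H_def add.commute)
  finally show ?case
    using Suc.prems c(1)
    by (intro p_integral_congI) (auto intro!: p_integral_intros p_integral_H p_integral_divide_Suc)
qed

text \<open>The binomial is the product of 1 + p/i over 1 \<le> i \<le> k. The case k = p - 1
  supplies C(2p-1,p-1) modulo p.\<close>

lemma choose_p_plus_cong: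
  "k < p \<Longrightarrow> p_integral_cong p (of_nat (p + k choose k)) 1 (of_nat p)"
proof (induction k)
  case 0
  then show ?case by (simp add: p_integral_cong_refl p_integral_numeral)
next
  case (Suc k)
  let ?s = "of_nat k + 1 :: rat"
  have nz: "?s \<noteq> 0" using of_nat_neq_0[of k, where 'a = rat] by (simp add: add.commute)
  have "(of_nat (Suc k) * of_nat (p + Suc k choose Suc k) :: rat)
      = of_nat (Suc (p + k)) * of_nat (p + k choose k)"
    using Suc_times_binomial[of k "p + k"] by (metis add_Suc_right of_nat_mult)
  then have "of_nat (p + Suc k choose Suc k) = (1 + of_nat p * (1 / ?s)) * of_nat (p + k choose k)"
    using nz by (simp add: field_simps del: binomial_Suc_Suc)
  moreover have "p_integral_cong p (1 + of_nat p * (1 / ?s)) 1 (of_nat p)"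
    using Suc.prems by (intro p_integral_congI[OF _ _ _ refl] p_integral_divide_Suc p_integral_intros)
  ultimately show ?case
    using p_integral_cong_mult[OF _ Suc.IH, of _ 1] Suc.prems by simp
qed

end

section \<open>Normalised central binomials modulo powers of an odd prime\<close>

lemma odd_prime_not_dvd_power_4:
  fixes p :: nat
  assumes "prime p" "odd p"
  shows "\<not> p dvd 4 ^ k"
proof -
  have "\<not> p dvd 2"
    using assms primes_dvd_imp_eq two_is_prime_nat by blast
  then show ?thesis
    using assms prime_dvd_power[of p 4 k] prime_dvd_mult_iff[of p 2 2] by auto
qed

lemma p_integral_divide_power_4:
  assumes "prime p" "odd p"
  shows "of_nat n / 4 ^ k \<in> p_integral_rats p"
  using p_integral_divide[OF assms(1) p_integral_of_nat odd_prime_not_dvd_power_4] assms by simp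

lemma p_integral_cb: "prime p \<Longrightarrow> odd p \<Longrightarrow> cb k \<in> p_integral_rats p"
  unfolding cb_def by (rule p_integral_divide_power_4)

text \<open>Absorption gives c_(p-1) = p C(2p-1,p-1) / (4^(p-1) (2p-1)). Modulo p the binomial is 1,
  the power of 4 is 1 by Fermat, and 2p - 1 is -1, so the cofactor of p is -1 and its square is 1.
  The factor p^2 raises the modulus to p^3.\<close>

lemma cb_p_minus_1_squared_cong:
  assumes p: "prime p" and odd: "odd p"
  shows "p_integral_cong p ((cb (p - 1))\<^sup>2) ((of_nat p)\<^sup>2) (of_nat p ^ 3)"
proof -
  note intros = p_integral_intros[OF p]
  let ?P = "of_nat p :: rat"
  have p2: "p > 2" using p odd prime_gt_1_nat[OF p] by (cases "p = 2") auto
  have ndvd4: "\<not> p dvd 4"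
    using odd_prime_not_dvd_power_4[OF assms, of 1] by simp
  let ?C = "of_nat (p + (p - 1) choose (p - 1)) :: rat"
  have nz: "2 * ?P - 1 \<noteq> 0"
  proof -
    have "2 * ?P - 1 = of_nat (2 * p - 1)" using p2 by (simp add: of_nat_diff)
    also have "\<dots> \<noteq> 0" using p2 by (subst of_nat_eq_0_iff) auto
    finally show ?thesis .
  qed
  have "p * (p + (p - 1) choose (p - 1)) = (2 * p - 1) * (2 * (p - 1) choose (p - 1))"
  proof -
    have "Suc (2 * (p - 1)) = p + (p - 1)" "Suc (2 * (p - 1)) = 2 * p - 1" "p + (p - 1) - (p - 1) = p"
      "p + (p - 1) - 1 = 2 * (p - 1)"
      using p2 by auto
    then show ?thesis using binomial_absorb_comp[of "p + (p - 1)" "p - 1"] by metis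
  qed
  then have "?P * ?C = of_nat (2 * p - 1) * of_nat (2 * (p - 1) choose (p - 1))"
    by (simp only: flip: of_nat_mult)
  then have PC: "?P * ?C = (2 * ?P - 1) * of_nat (2 * (p - 1) choose (p - 1))"
    using p2 by (simp add: of_nat_diff)
  \<comment> \<open>Kept as the cast of one natural number so that \<open>p_integral_divide\<close>
    applies to it.\<close>
  define D where "D = (of_nat (4 ^ (p - 1) * (2 * p - 1)) :: rat)"
  have D: "D = 4 ^ (p - 1) * (2 * ?P - 1)"
    using p2 by (simp add: D_def of_nat_diff)
  have cb: "cb (p - 1) = ?P * (?C / D)"
    unfolding times_divide_eq_right PC D cb_def using nz by simp
  have "p - 1 < p" using p2 by simp
  from p_integral_congE[OF p choose_p_plus_cong[OF p this]]
  obtain c where c: "c \<in> p_integral_rats p" "?C = 1 + ?P * c" .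
  obtain d where d: "d \<in> p_integral_rats p" "4 ^ (p - 1) = 1 + ?P * d"
    using p_integral_congE[OF p p_integral_cong_of_nat[OF p fermat_theorem[OF p ndvd4]]] by auto
  have ndvd: "\<not> p dvd 4 ^ (p - 1) * (2 * p - 1)"
  proof
    assume "p dvd 4 ^ (p - 1) * (2 * p - 1)"
    then have "p dvd 2 * p - 1"
      using prime_dvd_mult_iff[OF p] prime_dvd_power[OF p] ndvd4 by blast
    \<comment> \<open>Here p would divide 2p - (2p - 1) = 1.\<close>
    from dvd_diff_nat[OF _ this, of "2 * p"] show False using p2 by simp
  qed
  have div_D: "x / D \<in> p_integral_rats p" if "x \<in> p_integral_rats p" for x
    using p_integral_divide[OF p that ndvd] by (simp only: D_def)
  have "D \<noteq> 0" using nz by (simp add: D)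
  \<comment> \<open>Since \<open>?C\<close> is 1 and \<open>D\<close> is -1 modulo p, the sum is a
    multiple of p; dividing by \<open>D\<close> gives the quotient -1 modulo p with an explicit
    witness.\<close>
  have "?C + D = ?P * (c + 2 + (2 * ?P - 1) * d)"
    unfolding c(2) D d(2) by (simp add: algebra_simps)
  then have "?C / D = - 1 + ?P * ((c + 2 + (2 * ?P - 1) * d) / D)"
    using \<open>D \<noteq> 0\<close> by (simp add: field_simps)
  then have "p_integral_cong p (?C / D) (- 1) ?P"
    by (intro p_integral_congI[OF p, where c = "(c + 2 + (2 * ?P - 1) * d) / D"] intros div_D c d)
  from p_integral_cong_mult[OF p this this]
  have "p_integral_cong p ((?C / D)\<^sup>2) 1 ?P" by (simp add: power2_eq_square)
  from p_integral_cong_scale[OF p this p_integral_power[OF p p_integral_of_nat[OF p]], of p 2]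
  show ?thesis unfolding cb power_mult_distrib by (simp add: power3_eq_cube power2_eq_square)
qed

text \<open>The prime divides (2k)! but not k!, so it must divide the quotient (2k)!/(k!)^2.\<close>

lemma dvd_central_binomial:
  assumes p: "prime p" and "k < p" "p \<le> 2 * k"
  shows "p dvd (2 * k choose k)"
proof -
  have "fact k * fact k * (2 * k choose k) = (fact (2 * k) :: nat)"
    using binomial_fact_lemma[of k "2 * k"] by simp
  then have "p dvd fact k * fact k * (2 * k choose k)"
    using assms by (simp add: prime_dvd_fact_iff)
  then show ?thesis
    using assms by (simp add: prime_dvd_mult_iff prime_dvd_fact_iff)
qed

section \<open>Assembly over the ranges k \<le> h, h < k < p - 1 and k = p - 1, where p = 2h +
  1\<close>

theorem theorem2p6:
  fixes p :: nat
  assumes "prime p" and "odd p"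
  shows "p_integral_cong p
    (\<Sum>n=0..p - 1. of_nat (G n) / 16 ^ n)
    (of_nat p ^ 2 *
      (1 - (\<Sum>k=0..(p - 1) div 2.
              of_nat (((2 * k) choose k)^2) / (16 ^ k * of_nat (k + 1)) * H k)))
    (of_nat p ^ 3)"
proof -
  note p = \<open>prime p\<close>
  note intros = p_integral_intros[OF p] p_integral_cb[OF assms]
  let ?P = "of_nat p :: rat"
  define h where "h = (p - 1) div 2"
  have p2: "p > 2" using p \<open>odd p\<close> prime_gt_1_nat[OF p] by (cases "p = 2") auto
  have p_eq: "p = 2 * h + 1" using \<open>odd p\<close> by (auto simp: h_def elim: oddE)
  \<comment> \<open>\<open>t\<close> is the summand of \<open>sum_G\<close> at N = p - 1;
    \<open>u\<close> is the summand of the claimed right-hand side.\<close>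
  define t where "t k = (- 1) ^ k * of_nat (p choose Suc k) * (cb k)\<^sup>2" for k
  define u where "u k = (cb k)\<^sup>2 / (of_nat k + 1) * H k" for k

  have small: "p_integral_cong p (t k) (?P * ((cb k)\<^sup>2 / (of_nat k + 1)) - ?P\<^sup>2 * u k) (?P ^ 3)"
    if "k \<in> {0..h}" for k
  proof -
    let ?w = "(cb k)\<^sup>2 / (of_nat k + 1)"
    have k: "Suc k < p" using that p2 p_eq by auto
    have w: "?w \<in> p_integral_rats p"
      using k by (intro p_integral_divide_Suc[OF p] intros)
    have "Suc k * (p choose Suc k) = p * (p - 1 choose k)"
      by (rule binomial_absorption)
    then have "(of_nat (Suc k) * of_nat (p choose Suc k) :: rat) = ?P * of_nat (p - 1 choose k)"
      by (simp only: flip: of_nat_mult)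
    then have choose: "of_nat (p choose Suc k) = ?P * of_nat (p - 1 choose k) / (of_nat k + 1)"
      using of_nat_neq_0[of k, where 'a = rat] by (simp add: field_simps)
    have "p_integral_cong p ((- 1) ^ k * of_nat (p - 1 choose k)) (1 - ?P * H k) (?P ^ 2)"
      using k by (intro choose_p_minus_1_cong[OF p]) simp
    \<comment> \<open>The factor p extracted from C(p,k+1) lifts the modulus from p^2 to p^3; the
      integral factor \<open>?w\<close> in the new modulus is discarded at the end.\<close>
    from p_integral_cong_scale[OF p this p_integral_mult[OF p p_integral_of_nat[OF p] w]]
    have "p_integral_cong p (?P * ?w * ((- 1) ^ k * of_nat (p - 1 choose k)))
        (?P * ?w * (1 - ?P * H k)) (?P * ?w * ?P ^ 2)" .
    also have "?P * ?w * ?P ^ 2 = ?P ^ 3 * ?w"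
      by (simp add: power3_eq_cube power2_eq_square)
    also have "?P * ?w * ((- 1) ^ k * of_nat (p - 1 choose k)) = t k"
      unfolding t_def choose by simp
    also have "?P * ?w * (1 - ?P * H k) = ?P * ?w - ?P\<^sup>2 * u k"
      by (simp add: u_def right_diff_distrib power2_eq_square)
    finally show ?thesis by (rule p_integral_cong_modulus[OF p _ w])
  qed

  have middle: "p_integral_cong p (t k) 0 (?P ^ 3)" if "k \<in> {h<..<p - 1}" for k
  proof -
    have "p dvd (p choose Suc k)"
      using that p by (intro dvd_choose_prime) auto
    then obtain a where a: "p choose Suc k = p * a" by blast
    have "p dvd (2 * k choose k)"
      using that p p_eq by (intro dvd_central_binomial) auto
    then obtain b where b: "2 * k choose k = p * b" by blast
    show ?thesis
      \<comment> \<open>One factor p comes from C(p,k+1) and two from the squared central binomial;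
        the witness is what remains.\<close>
      by (intro p_integral_congI[OF p, where c = "(- 1) ^ k * of_nat a * (of_nat b / 4 ^ k)\<^sup>2"] intros
        p_integral_divide_power_4[OF assms])
        (simp_all add: t_def cb_def a b power3_eq_cube power2_eq_square)
  qed

  \<comment> \<open>Here C(p,p) = 1, and the sign is + because p - 1 is even.\<close>
  have last: "p_integral_cong p (t (p - 1)) (?P\<^sup>2) (?P ^ 3)"
    using cb_p_minus_1_squared_cong[OF assms] p2 \<open>odd p\<close> by (simp add: t_def)

  have u_int: "u k \<in> p_integral_rats p" if "k \<in> {0..h}" for k
    unfolding u_def using that p2 p_eq
    by (intro p_integral_mult[OF p] p_integral_divide_Suc[OF p] p_integral_H[OF p] intros) auto
  have "(\<Sum>k=0..h. ?P * ((cb k)\<^sup>2 / (of_nat k + 1)) - ?P\<^sup>2 * u k)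
      = ?P * (\<Sum>k=0..h. (cb k)\<^sup>2 / of_nat (k + 1)) - ?P\<^sup>2 * sum u {0..h}"
    by (simp add: sum_subtractf sum_distrib_left add.commute)
  \<comment> \<open>The closed form at \<open>h\<close> thus carries p^2; with the outer factor p it
    disappears modulo p^3, its cofactor being integral as h + 1 < p.\<close>
  also have "2 * of_nat h + 1 = ?P" using p_eq by simp
  then have "(\<Sum>k=0..h. (cb k)\<^sup>2 / of_nat (k + 1)) = ?P\<^sup>2 * ((cb h)\<^sup>2 / (of_nat h + 1))"
    unfolding sum_cb_squared_over_Suc by (simp add: add.commute)
  finally have "(\<Sum>k=0..h. ?P * ((cb k)\<^sup>2 / (of_nat k + 1)) - ?P\<^sup>2 * u k)
      = - ?P\<^sup>2 * sum u {0..h} + ?P ^ 3 * ((cb h)\<^sup>2 / (of_nat h + 1))"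
    by (simp add: power3_eq_cube power2_eq_square)
  then have "p_integral_cong p (\<Sum>k=0..h. ?P * ((cb k)\<^sup>2 / (of_nat k + 1)) - ?P\<^sup>2 * u k)
      (- ?P\<^sup>2 * sum u {0..h}) (?P ^ 3)"
    using p2 p_eq
    by (intro p_integral_congI[OF p, where c = "(cb h)\<^sup>2 / (of_nat h + 1)"]
        p_integral_divide_Suc[OF p] intros u_int) auto
  with p_integral_cong_sum[OF p small]
  have "p_integral_cong p (sum t {0..h}) (- ?P\<^sup>2 * sum u {0..h}) (?P ^ 3)"
    by (rule p_integral_cong_trans[OF p])
  moreover have "p_integral_cong p (sum t {h<..<p - 1}) (\<Sum>k\<in>{h<..<p - 1}. 0) (?P ^ 3)"
    by (intro p_integral_cong_sum[OF p] middle)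
  ultimately
  have "p_integral_cong p (sum t {0..h} + sum t {h<..<p - 1}) (- ?P\<^sup>2 * sum u {0..h}) (?P ^ 3)"
    using p_integral_cong_add[OF p] by fastforce
  \<comment> \<open>The term k = p - 1 contributes the leading 1 inside the bracket.\<close>
  from p_integral_cong_add[OF p this last]
  have "p_integral_cong p (sum t {0..h} + sum t {h<..<p - 1} + t (p - 1))
      (?P\<^sup>2 * (1 - sum u {0..h})) (?P ^ 3)"
    by (simp add: algebra_simps)
  moreover have "(\<Sum>n=0..p - 1. of_nat (G n) / 16 ^ n) = sum t {0..h} + sum t {h<..<p - 1} + t (p - 1)"
  proof -
    have "{0..p - 1} = insert (p - 1) ({0..h} \<union> {h<..<p - 1})"
      using p2 p_eq by auto
    moreover have "sum t ({0..h} \<union> {h<..<p - 1}) = sum t {0..h} + sum t {h<..<p - 1}"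
      by (rule sum.union_disjoint) auto
    ultimately have "sum t {0..p - 1} = sum t {0..h} + sum t {h<..<p - 1} + t (p - 1)"
      using p2 p_eq by simp
    moreover have "(\<Sum>n=0..p - 1. of_nat (G n) / 16 ^ n) = sum t {0..p - 1}"
      unfolding sum_G using p2 by (simp add: t_def)
    ultimately show ?thesis by simp
  qed
  moreover have "u k = of_nat (((2 * k) choose k)^2) / (16 ^ k * of_nat (k + 1)) * H k" for k
  proof -
    have "(16 :: rat) ^ k = (4 * 4) ^ k" by simp
    also have "\<dots> = (4 ^ k)\<^sup>2" by (simp only: power_mult_distrib power2_eq_square)
    finally have "(16 :: rat) ^ k = (4 ^ k)\<^sup>2" .
    then show ?thesis
      by (simp add: u_def cb_def power_divide add.commute)
  qed
  ultimately show ?thesis by (simp add: h_def)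
qed

end
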